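(* For each $k \ge 0$ let $A_k(z) = \sum_{n \geq 0} \mathcal{B}_{k,n} z^n$ ($z \in \mathbb{C}$) be the univariate ordinary generating function of the $k$-th row of the Binomiacci numbers, and let $G(z,w) = \sum_{k \geq 0} \sum_{n \geq 0} \mathcal{B}_{k,n} z^n w^k$ ($z,w \in \mathbb{C}$) be the corresponding bivariate generating function. Then $$A_k(z) = \begin{cases} \dfrac{1}{1-z-z^2}, & \text{if } k=0,\\[2mm] \dfrac{1}{(1-z)(1-z-z^2)}, & \text{if } k=1,\\[2mm] \dfrac{1}{(1-z)^k(1-z-z^2)} + \displaystyle\sum_{i=0}^{k-2} \frac{\mathcal{F}_i}{(1-z)^{k-1-i}}, & \text{if } k \geq 2, \end{cases}$$ and $$G(z,w) = \frac{1 - z - w + zw - z^2 w^2}{(1-z-z^2)(1-w-w^2)(1-z-w)}.$$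
   Context: $\langle \mathcal{F}_j \rangle_{j\ge 0} = \langle 1,1,2,3,5,8,13,\ldots\rangle$ is the Fibonacci sequence indexed so that $\mathcal{F}_0=\mathcal{F}_1=1$ and $\mathcal{F}_{j+2}=\mathcal{F}_{j+1}+\mathcal{F}_j$. The Binomiacci numbers $\langle \mathcal{B}_{k,n}\rangle_{k,n\ge 0}$ are defined by $\mathcal{B}_{0,n}=\mathcal{F}_n$ for $n\ge 0$, $\mathcal{B}_{k,0}=\mathcal{F}_k$ for $k\ge 0$, and $\mathcal{B}_{k,n}=\mathcal{B}_{k,n-1}+\mathcal{B}_{k-1,n}$ for $k,n\ge 1$. The identities are identities of (formal) power series, i.e. the rational functions are expanded at the origin. *)

theory Defs
  imports Complex_Main "HOL-Computational_Algebra.Formal_Power_Series"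
begin

(* Indexed as 1, 1, 2, 3, 5, ..., i.e. shifted by one against the library's fib. *)
fun fibonacci :: "nat \<Rightarrow> nat" where
  "fibonacci 0 = 1"
| "fibonacci (Suc 0) = 1"
| "fibonacci (Suc (Suc j)) = fibonacci (Suc j) + fibonacci j"

fun binomiacci :: "nat \<Rightarrow> nat \<Rightarrow> nat" where
  "binomiacci 0 n = fibonacci n"
| "binomiacci (Suc k) 0 = fibonacci (Suc k)"
| "binomiacci (Suc k) (Suc n) = binomiacci (Suc k) n + binomiacci k (Suc n)"

definition row_gf :: "nat \<Rightarrow> complex fps" where
  "row_gf k = Abs_fps (\<lambda>n. of_nat (binomiacci k n))"

(* C[[z,w]] is represented as C[[z]][[w]]: the k-th coefficient of an element
   of this ring is the power series in z multiplying w^k. *)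
definition z_var :: "complex fps fps" where
  "z_var = fps_const fps_X"

definition w_var :: "complex fps fps" where
  "w_var = fps_X"

definition bivariate_gf :: "complex fps fps" where
  "bivariate_gf = Abs_fps (\<lambda>k. Abs_fps (\<lambda>n. of_nat (binomiacci k n)))"

(* Division in C[[z,w]] by a series with nonzero constant term is genuine, so
   quotients of polynomials with such denominators are expansions at the origin. *)
lemma bivariate_divide_times:
  fixes f g :: "complex fps fps"
  assumes "fps_nth (fps_nth g 0) 0 \<noteq> 0"
  shows "f / g * g = f"
proof -
  have "fps_nth g 0 \<noteq> 0" using assms by auto
  then have s: "subdegree g = 0" by simp
  have i: "fps_nth g 0 * inverse (fps_nth g 0) = 1"
    using assms by (simp add: inverse_mult_eq_1')
  have "g * inverse g = 1"
    unfolding fps_inverse_def[of g] by (rule fps_right_inverse[OF i])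
  moreover have "f / g = f * inverse g"
    using s by (simp add: fps_divide_def)
  ultimately show ?thesis by (metis mult.assoc mult.commute mult.right_neutral)
qed

end

theory Submission
  imports Defs
begin

text \<open>
  The recurrence says that \<open>(1 - z) A\<^sub>k\<^sub>+\<^sub>1\<close> and \<open>A\<^sub>k\<close> differ only in the constant
  coefficient, by \<open>F\<^sub>k\<^sub>+\<^sub>1 - F\<^sub>k\<close>, which is \<open>0\<close> for \<open>k = 0\<close> and \<open>F\<^sub>k\<^sub>-\<^sub>1\<close> otherwise. Iterating
  gives the rows; multiplying by \<open>w\<^sup>k\<^sup>+\<^sup>1\<close> and summing gives
  \<open>(1 - z - w) G = (1 - z) / (1 - z - z\<^sup>2) + w\<^sup>2 / (1 - w - w\<^sup>2)\<close>.
\<close>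

text \<open>Polymorphic because it is needed both over \<open>complex\<close>, as a series in z, and
  over \<open>complex fps\<close>, as a series in w.\<close>

definition fibonacci_gf :: "'a::comm_ring_1 fps" where
  "fibonacci_gf = Abs_fps (\<lambda>n. of_nat (fibonacci n))"

lemma fibonacci_gf_mult: "(1 - fps_X - fps_X ^ 2) * fibonacci_gf = 1"
proof (rule fps_ext)
  fix n
  consider "n = 0" | "n = 1" | m where "n = Suc (Suc m)"
    by (metis One_nat_def not0_implies_Suc)
  then show "fps_nth ((1 - fps_X - fps_X ^ 2) * fibonacci_gf) n = fps_nth (1 :: 'a fps) n"
    by cases (simp_all add: fibonacci_gf_def left_diff_distrib power2_eq_square mult.assoc)
qed

lemma row_gf_0: "row_gf 0 = fibonacci_gf"
  by (simp add: row_gf_def fibonacci_gf_def)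

text \<open>The case \<open>k = 0\<close> is split off because truncated subtraction would turn the
  correction into \<open>fibonacci 0\<close>, which is 1 and not 0.\<close>

lemma row_gf_Suc:
  "(1 - fps_X) * row_gf (Suc k)
   = row_gf k + (if k = 0 then 0 else of_nat (fibonacci (k - 1)))"
proof (rule fps_ext)
  fix n
  show "fps_nth ((1 - fps_X) * row_gf (Suc k)) n
        = fps_nth (row_gf k + (if k = 0 then 0 else of_nat (fibonacci (k - 1)))) n"
  proof (cases n)
    case 0
    have "binomiacci j 0 = fibonacci j" for j by (cases j) simp_all
    with 0 show ?thesis
      by (cases k) (simp_all add: row_gf_def left_diff_distrib fps_of_nat [symmetric])
  next
    case (Suc m)
    then show ?thesis by (simp add: row_gf_def left_diff_distrib fps_of_nat [symmetric])
  qed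
qed

text \<open>The range \<open>i < k - 1\<close> is empty for \<open>k \<le> 1\<close>, so one formula
  covers all three cases and suits induction.\<close>

lemma row_gf_closed:
  "row_gf k = inverse (1 - fps_X) ^ k * fibonacci_gf
     + (\<Sum>i<k - 1. of_nat (fibonacci i) * inverse (1 - fps_X) ^ (k - 1 - i))"
proof (induction k)
  case 0
  show ?case by (simp add: row_gf_0)
next
  case (Suc k)
  define u :: "complex fps" where "u = inverse (1 - fps_X)"
  have u: "u * (1 - fps_X) = 1"
    unfolding u_def by (rule inverse_mult_eq_1) simp
  have "row_gf (Suc k) = u * ((1 - fps_X) * row_gf (Suc k))"
    using u by (simp flip: mult.assoc)
  then have step: "row_gf (Suc k)
      = u * (row_gf k + (if k = 0 then 0 else of_nat (fibonacci (k - 1))))"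
    by (simp only: row_gf_Suc)
  show ?case
  proof (cases k)
    case 0
    then show ?thesis using step by (simp add: row_gf_0 u_def)
  next
    case (Suc m)
    \<comment> \<open>The old summands each gain a factor \<open>u\<close>; the correction in
      \<open>step\<close> supplies the new summand \<open>i = m\<close>, with exponent 1.\<close>
    have "(\<Sum>i<m. of_nat (fibonacci i) * u ^ (Suc m - i))
          = u * (\<Sum>i<m. of_nat (fibonacci i) * u ^ (m - i))"
      unfolding sum_distrib_left by (rule sum.cong) (simp_all add: Suc_diff_le mult_ac)
    then show ?thesis
      using step Suc.IH Suc by (simp add: algebra_simps flip: u_def)
  qed
qed

text \<open>Compare coefficients of powers of w: \<open>w^0\<close> gives row 0 times 1 - z,
  \<open>w^1\<close> gives 0, and \<open>w^(m+2)\<close> gives the correction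
  \<open>fibonacci m\<close> of \<open>row_gf_Suc\<close>.\<close>

lemma bivariate_gf_mult:
  "(1 - z_var - w_var) * bivariate_gf
   = (1 - z_var) * fps_const fibonacci_gf + w_var ^ 2 * fibonacci_gf"
proof (rule fps_ext)
  fix k
  have G: "bivariate_gf = Abs_fps row_gf"
    by (simp add: bivariate_gf_def row_gf_def [abs_def])
  have z: "1 - z_var = fps_const (1 - fps_X)"
    by (simp add: z_var_def flip: fps_const_sub)
  have "fps_nth ((fps_const (1 - fps_X) - fps_X) * Abs_fps row_gf) k
     = fps_nth (fps_const (1 - fps_X) * fps_const fibonacci_gf + fps_X ^ 2 * fibonacci_gf) k"
  proof (cases k)
    case 0
    then show ?thesis by (simp add: left_diff_distrib row_gf_0 power2_eq_square mult.assoc)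
  next
    case (Suc m)
    then show ?thesis using row_gf_Suc [of m]
      by (cases m) (simp_all add: left_diff_distrib power2_eq_square mult.assoc fibonacci_gf_def)
  qed
  then show "fps_nth ((1 - z_var - w_var) * bivariate_gf) k
     = fps_nth ((1 - z_var) * fps_const fibonacci_gf + w_var ^ 2 * fibonacci_gf) k"
    unfolding G z w_var_def .
qed

lemma row_gf_formula:
  "row_gf k =
     (if k = 0 then 1 / (1 - fps_X - fps_X ^ 2)
      else if k = 1 then 1 / ((1 - fps_X) * (1 - fps_X - fps_X ^ 2))
      else 1 / ((1 - fps_X) ^ k * (1 - fps_X - fps_X ^ 2))
           + (\<Sum>i = 0..k - 2. of_nat (fibonacci i) / (1 - fps_X) ^ (k - 1 - i)))"
proof -
  have "inverse (1 - fps_X - fps_X ^ 2) = (fibonacci_gf :: complex fps)"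
    by (rule fps_inverse_unique) (rule fibonacci_gf_mult)
  then have main: "1 / ((1 - fps_X) ^ k * (1 - fps_X - fps_X ^ 2))
      = inverse (1 - fps_X) ^ k * (fibonacci_gf :: complex fps)"
    by (simp add: fps_divide_unit fps_inverse_mult fps_inverse_power)
  have summand: "(of_nat a :: complex fps) / (1 - fps_X) ^ j = of_nat a * inverse (1 - fps_X) ^ j"
    for a j
    by (simp add: fps_divide_unit fps_inverse_power)
  consider "k = 0" | "k = 1" | "k \<ge> 2" by linarith
  then show ?thesis
  proof cases
    case 3
    \<comment> \<open>This uses \<open>k \<ge> 2\<close>: for \<open>k = 1\<close> the left side
      would be {0} and the right side empty.\<close>
    then have "{0..k - 2} = {..<k - 1}" by auto
    then show ?thesis using 3 row_gf_closed [of k] main by (simp add: summand)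
  qed (use row_gf_closed [of k] main in simp_all)
qed

lemma bivariate_gf_formula:
  "bivariate_gf =
     (1 - z_var - w_var + z_var * w_var - z_var ^ 2 * w_var ^ 2)
     / ((1 - z_var - z_var ^ 2) * (1 - w_var - w_var ^ 2) * (1 - z_var - w_var))"
    (is "_ = ?N / ?D")
proof -
  define P :: "complex fps fps" where "P = fps_const fibonacci_gf"
  define Q :: "complex fps fps" where "Q = fibonacci_gf"
  have "1 - z_var - z_var ^ 2 = fps_const (1 - fps_X - fps_X ^ 2)"
    by (simp add: z_var_def fps_const_power flip: fps_const_sub)
  then have P: "(1 - z_var - z_var ^ 2) * P = 1"
    by (simp only: P_def fps_const_mult fibonacci_gf_mult fps_const_1_eq_1)
  have Q: "(1 - w_var - w_var ^ 2) * Q = 1"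
    unfolding Q_def w_var_def by (rule fibonacci_gf_mult)
  have "bivariate_gf * ?D
      = (1 - z_var - z_var ^ 2) * (1 - w_var - w_var ^ 2) * ((1 - z_var - w_var) * bivariate_gf)"
    by (simp only: mult_ac)
  also have "\<dots> = (1 - z_var) * (1 - w_var - w_var ^ 2) * ((1 - z_var - z_var ^ 2) * P)
      + w_var ^ 2 * (1 - z_var - z_var ^ 2) * ((1 - w_var - w_var ^ 2) * Q)"
    unfolding bivariate_gf_mult P_def [symmetric] Q_def [symmetric]
    by (simp only: distrib_left mult_ac)
  \<comment> \<open>What remains is (1 - z)(1 - w - w^2) + w^2 (1 - z - z^2), where the terms w^2
    and z w^2 cancel.\<close>
  also have "\<dots> = ?N"
    unfolding P Q by (simp add: algebra_simps)
  finally have GD: "bivariate_gf * ?D = ?N" .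
  \<comment> \<open>All three factors of \<open>?D\<close> have constant term 1, so the quotient is
    genuine, and \<open>?D\<close> can be cancelled in the domain C[[z]][[w]].\<close>
  have const: "fps_nth (fps_nth ?D 0) 0 \<noteq> 0"
    by (simp add: z_var_def w_var_def)
  then have "?D \<noteq> 0" by (metis fps_zero_nth)
  moreover have "bivariate_gf * ?D = ?N / ?D * ?D"
    unfolding GD by (rule bivariate_divide_times [OF const, symmetric])
  ultimately show ?thesis by (metis mult_right_cancel)
qed

theorem lemma2p1:
  shows "(\<forall>k. row_gf k =
           (if k = 0 then 1 / (1 - fps_X - fps_X ^ 2)
            else if k = 1 then 1 / ((1 - fps_X) * (1 - fps_X - fps_X ^ 2))
            else 1 / ((1 - fps_X) ^ k * (1 - fps_X - fps_X ^ 2))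
                 + (\<Sum>i = 0..k - 2. of_nat (fibonacci i) / (1 - fps_X) ^ (k - 1 - i))))
       \<and> bivariate_gf =
           (1 - z_var - w_var + z_var * w_var - z_var ^ 2 * w_var ^ 2)
           / ((1 - z_var - z_var ^ 2) * (1 - w_var - w_var ^ 2) * (1 - z_var - w_var))"
  using row_gf_formula bivariate_gf_formula by blast

end
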